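(* Let $X$ be a random vector in $\mathbb{R}^p$, $\beta_0\in\mathbb{R}^p$, $b$ a function with second derivative $b''\ge0$, $L$ a fixed matrix, and define $$\Phi:=\mathbb{E}\{b''(X^T\beta_0)XX^T\},\qquad \Gamma:=\mathbb{E}\left[\{b''(X^T\beta_0)\}^{3/2}\|L\Phi^{-1}X\|XX^T\right],$$ $$\Lambda:=\mathbb{E}\left\{\frac{b''(X^T\beta_0)XX^T}{\sqrt{b''(X^T\beta_0)}\,\|L\Phi^{-1}X\|}\right\},\qquad \Omega:=\mathbb{E}\left[\{b''(X^T\beta_0)\}^{2}\|L\Phi^{-1}X\|^2XX^T\right].$$ If $\Phi$, $\Gamma$ and $\Lambda$ are finite and positive-definite (and $\Omega$ is finite), then $$\Gamma^{-1}\le\Phi^{-1}\Lambda\Phi^{-1}\qquad\text{and}\qquad \Gamma^{-1}\Omega\Gamma^{-1}\ge\Phi^{-1},$$ where the inequalities are in the Loewner ordering.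
   Context: $\|\cdot\|$ is the Euclidean norm. For symmetric matrices, $A\ge B$ in the Loewner ordering means $A-B$ is positive semi-definite. The setting is a generalized linear model in which the conditional density of $Y$ given $X=x$ is proportional to $\exp\{y\,x^T\beta_0-b(x^T\beta_0)\}$, so that $b''(X^T\beta_0)=\mathrm{Var}(Y\mid X)\ge0$. The definition of $\Lambda$ presupposes that $\sqrt{b''(X^T\beta_0)}\,\|L\Phi^{-1}X\|>0$ almost surely. *)

theory Defs
  imports "HOL-Probability.Probability"
begin

definition outer :: "real ^ 'n \<Rightarrow> real ^ 'n ^ 'n"
  where "outer x = (\<chi> i j. x $ i * x $ j)"

definition symmetric_mat :: "real ^ 'n ^ 'n \<Rightarrow> bool"
  where "symmetric_mat A \<longleftrightarrow> transpose A = A"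

definition pos_semidef :: "real ^ 'n ^ 'n \<Rightarrow> bool"
  where "pos_semidef A \<longleftrightarrow> symmetric_mat A \<and> (\<forall>v. 0 \<le> v \<bullet> (A *v v))"

definition pos_def :: "real ^ 'n ^ 'n \<Rightarrow> bool"
  where "pos_def A \<longleftrightarrow> symmetric_mat A \<and> (\<forall>v. v \<noteq> 0 \<longrightarrow> 0 < v \<bullet> (A *v v))"

text \<open>The order on \<^typ>\<open>real ^ 'n ^ 'n\<close> provided by the library is entrywise,
  so the Loewner ordering needs its own symbol.\<close>

definition loewner_le :: "real ^ 'n ^ 'n \<Rightarrow> real ^ 'n ^ 'n \<Rightarrow> bool"  (infix "\<preceq>\<^sub>L" 50)
  where "A \<preceq>\<^sub>L B \<longleftrightarrow> symmetric_mat A \<and> symmetric_mat B \<and> pos_semidef (B - A)"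

text \<open>The integrands below are matrix-valued functions of a value \<open>x\<close> of the covariate;
  \<open>b2\<close> stands for the second derivative \<open>b''\<close>.  Each expectation is a Bochner integral in
  \<^typ>\<open>real ^ 'n ^ 'n\<close>, i.e. entrywise, and equals 0 by convention if the integrand is not
  integrable; finiteness of a matrix therefore means integrability of its integrand.\<close>

definition Phi_integrand :: "(real \<Rightarrow> real) \<Rightarrow> real ^ 'n \<Rightarrow> real ^ 'n \<Rightarrow> real ^ 'n ^ 'n"
  where "Phi_integrand b2 \<beta>\<^sub>0 x = b2 (x \<bullet> \<beta>\<^sub>0) *\<^sub>R outer x"

definition Phi :: "'a measure \<Rightarrow> ('a \<Rightarrow> real ^ 'n) \<Rightarrow> (real \<Rightarrow> real) \<Rightarrow> real ^ 'n \<Rightarrow> real ^ 'n ^ 'n"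
  where "Phi M X b2 \<beta>\<^sub>0 = (\<integral>\<omega>. Phi_integrand b2 \<beta>\<^sub>0 (X \<omega>) \<partial>M)"

text \<open>In the remaining integrands \<open>P\<close> is a placeholder for the matrix \<^const>\<open>Phi\<close>.\<close>

definition Gamma_integrand ::
    "(real \<Rightarrow> real) \<Rightarrow> real ^ 'n \<Rightarrow> real ^ 'n ^ 'm \<Rightarrow> real ^ 'n ^ 'n \<Rightarrow> real ^ 'n \<Rightarrow> real ^ 'n ^ 'n"
  where "Gamma_integrand b2 \<beta>\<^sub>0 L P x =
    (b2 (x \<bullet> \<beta>\<^sub>0) powr (3/2) * norm ((L ** matrix_inv P) *v x)) *\<^sub>R outer x"

definition Gam :: "'a measure \<Rightarrow> ('a \<Rightarrow> real ^ 'n) \<Rightarrow> (real \<Rightarrow> real) \<Rightarrow> real ^ 'n \<Rightarrow>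
    real ^ 'n ^ 'm \<Rightarrow> real ^ 'n ^ 'n"
  where "Gam M X b2 \<beta>\<^sub>0 L = (\<integral>\<omega>. Gamma_integrand b2 \<beta>\<^sub>0 L (Phi M X b2 \<beta>\<^sub>0) (X \<omega>) \<partial>M)"

definition Lambda_denom ::
    "(real \<Rightarrow> real) \<Rightarrow> real ^ 'n \<Rightarrow> real ^ 'n ^ 'm \<Rightarrow> real ^ 'n ^ 'n \<Rightarrow> real ^ 'n \<Rightarrow> real"
  where "Lambda_denom b2 \<beta>\<^sub>0 L P x =
    sqrt (b2 (x \<bullet> \<beta>\<^sub>0)) * norm ((L ** matrix_inv P) *v x)"

definition Lambda_integrand ::
    "(real \<Rightarrow> real) \<Rightarrow> real ^ 'n \<Rightarrow> real ^ 'n ^ 'm \<Rightarrow> real ^ 'n ^ 'n \<Rightarrow> real ^ 'n \<Rightarrow> real ^ 'n ^ 'n"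
  where "Lambda_integrand b2 \<beta>\<^sub>0 L P x =
    (b2 (x \<bullet> \<beta>\<^sub>0) / Lambda_denom b2 \<beta>\<^sub>0 L P x) *\<^sub>R outer x"

definition Lam :: "'a measure \<Rightarrow> ('a \<Rightarrow> real ^ 'n) \<Rightarrow> (real \<Rightarrow> real) \<Rightarrow> real ^ 'n \<Rightarrow>
    real ^ 'n ^ 'm \<Rightarrow> real ^ 'n ^ 'n"
  where "Lam M X b2 \<beta>\<^sub>0 L = (\<integral>\<omega>. Lambda_integrand b2 \<beta>\<^sub>0 L (Phi M X b2 \<beta>\<^sub>0) (X \<omega>) \<partial>M)"

definition Omega_integrand ::
    "(real \<Rightarrow> real) \<Rightarrow> real ^ 'n \<Rightarrow> real ^ 'n ^ 'm \<Rightarrow> real ^ 'n ^ 'n \<Rightarrow> real ^ 'n \<Rightarrow> real ^ 'n ^ 'n"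
  where "Omega_integrand b2 \<beta>\<^sub>0 L P x =
    ((b2 (x \<bullet> \<beta>\<^sub>0))\<^sup>2 * (norm ((L ** matrix_inv P) *v x))\<^sup>2) *\<^sub>R outer x"

definition Omeg :: "'a measure \<Rightarrow> ('a \<Rightarrow> real ^ 'n) \<Rightarrow> (real \<Rightarrow> real) \<Rightarrow> real ^ 'n \<Rightarrow>
    real ^ 'n ^ 'm \<Rightarrow> real ^ 'n ^ 'n"
  where "Omeg M X b2 \<beta>\<^sub>0 L = (\<integral>\<omega>. Omega_integrand b2 \<beta>\<^sub>0 L (Phi M X b2 \<beta>\<^sub>0) (X \<omega>) \<partial>M)"

end

theory Submission
  imports Defs
begin

text \<open>Both inequalities have the form \<open>A\<^sup>-\<^sup>1 \<le> B\<^sup>-\<^sup>1 C B\<^sup>-\<^sup>1\<close>, where \<open>A\<close>, \<open>B\<close>, \<open>C\<close> are the expectations of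
  \<open>XX\<^sup>T\<close> with weights \<open>a, c \<ge> 0\<close> and \<open>\<beta>\<close> satisfying \<open>\<beta>\<^sup>2 = a c\<close>: take \<open>(A, B, C) = (\<Gamma>, \<Phi>, \<Lambda>)\<close> for the
  first and \<open>(\<Phi>, \<Gamma>, \<Omega>)\<close> for the second.  Integrating the arithmetic-geometric mean inequality
  \<open>2 \<beta> (u \<bullet> X) (v \<bullet> X) \<le> a (u \<bullet> X)\<^sup>2 + c (v \<bullet> X)\<^sup>2\<close> gives \<open>2 u \<bullet> B v \<le> u \<bullet> A u + v \<bullet> C v\<close>; then
  put \<open>u = A\<^sup>-\<^sup>1 w\<close> and \<open>v = B\<^sup>-\<^sup>1 w\<close>.\<close>

lemma pos_def_invertible:
  fixes A :: "real ^ 'n ^ 'n"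
  assumes "pos_def A"
  shows "invertible A"
proof -
  have "x = 0" if "A *v x = 0" for x
    using assms that unfolding pos_def_def by (metis inner_zero_right less_irrefl)
  then show ?thesis
    using invertible_left_inverse matrix_left_invertible_ker by blast
qed

lemma matrix_inv_left_right:
  fixes A :: "real ^ 'n ^ 'n"
  assumes "invertible A"
  shows "A ** matrix_inv A = mat 1" "matrix_inv A ** A = mat 1"
  \<comment> \<open>\<open>matrix_inv\<close> is a Hilbert choice, so its two equations follow from
    the existence of a two-sided inverse.\<close>
  using someI_ex [OF assms [unfolded invertible_def]] unfolding matrix_inv_def by blast+

lemma matrix_inv_mult_vector:
  fixes A :: "real ^ 'n ^ 'n"
  assumes "invertible A"
  shows "A *v (matrix_inv A *v w) = w"
  by (simp add: assms matrix_inv_left_right matrix_vector_mul_assoc)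

text \<open>Transposing \<open>A ** matrix_inv A = mat 1\<close> makes the transposed inverse a left
  inverse of the symmetric \<open>A\<close>, and a left inverse agrees with a right one.\<close>

lemma symmetric_mat_matrix_inv:
  fixes A :: "real ^ 'n ^ 'n"
  assumes "invertible A" "symmetric_mat A"
  shows "symmetric_mat (matrix_inv A)"
proof -
  have sym: "transpose A = A"
    using assms(2) by (simp add: symmetric_mat_def)
  have "transpose (matrix_inv A) ** A = transpose (A ** matrix_inv A)"
    by (simp add: matrix_transpose_mul sym)
  then have left_inverse: "transpose (matrix_inv A) ** A = mat 1"
    by (simp add: assms matrix_inv_left_right transpose_mat)
  have "transpose (matrix_inv A) = transpose (matrix_inv A) ** (A ** matrix_inv A)"
    by (simp add: assms matrix_inv_left_right)
  also have "\<dots> = matrix_inv A"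
    by (simp add: matrix_mul_assoc left_inverse)
  finally show ?thesis
    by (simp add: symmetric_mat_def)
qed

lemma symmetric_mat_inner:
  fixes A :: "real ^ 'n ^ 'n"
  assumes "symmetric_mat A"
  shows "u \<bullet> (A *v v) = (A *v u) \<bullet> v"
  using assms unfolding symmetric_mat_def by (metis dot_lmul_matrix matrix_transpose_mul transpose_matrix_vector)

lemma loewner_le_sandwich:
  fixes A B C :: "real ^ 'n ^ 'n"
  assumes A: "invertible A" "symmetric_mat A" and B: "invertible B" "symmetric_mat B"
    and C: "symmetric_mat C"
    and cs: "\<And>u v. 2 * (u \<bullet> (B *v v)) \<le> u \<bullet> (A *v u) + v \<bullet> (C *v v)"
  shows "matrix_inv A \<preceq>\<^sub>L matrix_inv B ** C ** matrix_inv B"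
proof -
  let ?A = "matrix_inv A" and ?B = "matrix_inv B"
  let ?D = "?B ** C ** ?B"
  have symA: "symmetric_mat ?A" and symB: "symmetric_mat ?B"
    using A B by (simp_all add: symmetric_mat_matrix_inv)
  have symD: "symmetric_mat ?D"
    using symB C by (simp add: symmetric_mat_def matrix_transpose_mul matrix_mul_assoc)
  have "symmetric_mat (?D - ?A)"
    using symA symD by (simp add: symmetric_mat_def transpose_def vec_eq_iff)
  moreover have "0 \<le> w \<bullet> ((?D - ?A) *v w)" for w
  proof -
    have "w \<bullet> (?D *v w) = (?B *v w) \<bullet> (C *v (?B *v w))"
      by (simp add: symmetric_mat_inner [OF symB] flip: matrix_vector_mul_assoc)
    \<comment> \<open>As \<open>A\<close> and \<open>B\<close> undo their inverses, the left side
      becomes twice \<open>w \<bullet> (?A *v w)\<close> and the first summand on the right one copy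
      of it. Cancelling that copy leaves the claim.\<close>
    with cs [of "?A *v w" "?B *v w"] show ?thesis
      by (simp add: matrix_inv_mult_vector A B matrix_vector_mult_diff_rdistrib
          inner_diff_right inner_commute)
  qed
  ultimately show ?thesis
    using symA symD by (simp add: loewner_le_def pos_semidef_def)
qed

lemma inner_outer: "u \<bullet> ((c *\<^sub>R outer x) *v v) = c * (u \<bullet> x) * (v \<bullet> x)"
  by (simp add: outer_def matrix_vector_mult_def inner_vec_def sum_product sum_distrib_left
      mult_ac)

text \<open>Bounded linearity in the matrix lets the form pass under the Bochner integral, which
  reduces matrix expectations to scalar ones.\<close>

lemma bounded_linear_quadratic_form:
  fixes u :: "real ^ 'm" and v :: "real ^ 'n"
  shows "bounded_linear (\<lambda>A. u \<bullet> (A *v v))"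
  by (rule linear_conv_bounded_linear [THEN iffD1], rule linearI)
    (simp_all add: matrix_vector_mult_add_rdistrib inner_add_right
      scaleR_matrix_vector_assoc [symmetric])

text \<open>Supplies the symmetry of the middle matrix \<open>C\<close> of the sandwich. Taking an
  entry commutes with the integral, and the integrand is symmetric in \<open>i\<close> and
  \<open>j\<close>.\<close>

lemma symmetric_mat_integral_outer:
  assumes "integrable M (\<lambda>\<omega>. c \<omega> *\<^sub>R outer (X \<omega>))"
  shows "symmetric_mat (\<integral>\<omega>. c \<omega> *\<^sub>R outer (X \<omega>) \<partial>M)"
proof -
  have entry: "(\<integral>\<omega>. c \<omega> *\<^sub>R outer (X \<omega>) \<partial>M) $ i $ j = (\<integral>\<omega>. c \<omega> * (X \<omega> $ i * X \<omega> $ j) \<partial>M)" for i j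
  proof -
    have "bounded_linear (\<lambda>A :: real ^ _ ^ _. A $ i $ j)"
      by (intro bounded_linear_compose [OF bounded_linear_vec_nth] bounded_linear_vec_nth)
    from integral_bounded_linear [OF this assms] show ?thesis
      by (simp add: outer_def)
  qed
  show ?thesis
    by (simp add: symmetric_mat_def transpose_def vec_eq_iff entry mult.commute)
qed

text \<open>The sign of \<open>b\<close> is free, but its modulus is \<open>sqrt a * sqrt c\<close>,
  so the bound is AM-GM for \<open>sqrt a * \<bar>p\<bar>\<close> and
  \<open>sqrt c * \<bar>q\<bar>\<close>.\<close>

lemma weighted_am_gm:
  fixes a b c p q :: real
  assumes "0 \<le> a" "0 \<le> c" "b\<^sup>2 = a * c"
  shows "2 * (b * p * q) \<le> a * p * p + c * q * q"
proof -
  have "\<bar>b\<bar> = sqrt a * sqrt c"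
    using assms by (metis real_sqrt_abs real_sqrt_mult)
  then have "2 * (b * p * q) \<le> 2 * (sqrt a * \<bar>p\<bar>) * (sqrt c * \<bar>q\<bar>)"
    using abs_ge_self [of "b * p * q"] by (simp add: abs_mult mult_ac)
  also have "\<dots> \<le> (sqrt a * \<bar>p\<bar>)\<^sup>2 + (sqrt c * \<bar>q\<bar>)\<^sup>2"
    by (rule sum_squares_bound)
  also have "\<dots> = a * p * p + c * q * q"
    using assms by (simp add: power_mult_distrib) (simp add: power2_eq_square)
  finally show ?thesis .
qed

lemma powr_three_halves:
  fixes t :: real
  assumes "0 \<le> t"
  shows "t powr (3/2) = t * sqrt t"
  using assms powr_add [of t 1 "1/2"] by (simp add: powr_half_sqrt)

text \<open>A matrix form of the Cauchy-Schwarz inequality. The weights are constrained almost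
  everywhere because the quotient in the \<Lambda> weight is controlled only where its denominator
  is positive.\<close>

lemma loewner_le_weighted_second_moments:
  fixes M :: "'a measure" and X :: "'a \<Rightarrow> real ^ 'n" and a b c :: "'a \<Rightarrow> real"
  defines "A \<equiv> \<integral>\<omega>. a \<omega> *\<^sub>R outer (X \<omega>) \<partial>M"
    and "B \<equiv> \<integral>\<omega>. b \<omega> *\<^sub>R outer (X \<omega>) \<partial>M"
    and "C \<equiv> \<integral>\<omega>. c \<omega> *\<^sub>R outer (X \<omega>) \<partial>M"
  assumes int: "integrable M (\<lambda>\<omega>. a \<omega> *\<^sub>R outer (X \<omega>))"
      "integrable M (\<lambda>\<omega>. b \<omega> *\<^sub>R outer (X \<omega>))"
      "integrable M (\<lambda>\<omega>. c \<omega> *\<^sub>R outer (X \<omega>))"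
    and "pos_def A" "pos_def B"
    and weights: "AE \<omega> in M. 0 \<le> a \<omega> \<and> 0 \<le> c \<omega> \<and> (b \<omega>)\<^sup>2 = a \<omega> * c \<omega>"
  shows "matrix_inv A \<preceq>\<^sub>L matrix_inv B ** C ** matrix_inv B"
proof (rule loewner_le_sandwich)
  fix u v :: "real ^ 'n"
  have form: "integrable M (\<lambda>\<omega>. d \<omega> * (y \<bullet> X \<omega>) * (z \<bullet> X \<omega>))"
      "y \<bullet> ((\<integral>\<omega>. d \<omega> *\<^sub>R outer (X \<omega>) \<partial>M) *v z) = (\<integral>\<omega>. d \<omega> * (y \<bullet> X \<omega>) * (z \<bullet> X \<omega>) \<partial>M)"
    if "integrable M (\<lambda>\<omega>. d \<omega> *\<^sub>R outer (X \<omega>))" for d y z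
    using integrable_bounded_linear [OF bounded_linear_quadratic_form that, of y z]
      integral_bounded_linear [OF bounded_linear_quadratic_form that, of y z]
    by (simp_all add: inner_outer)
  have "(\<integral>\<omega>. 2 * (b \<omega> * (u \<bullet> X \<omega>) * (v \<bullet> X \<omega>)) \<partial>M) \<le>
      (\<integral>\<omega>. a \<omega> * (u \<bullet> X \<omega>) * (u \<bullet> X \<omega>) + c \<omega> * (v \<bullet> X \<omega>) * (v \<bullet> X \<omega>) \<partial>M)"
  proof (rule integral_mono_AE)
    show "AE \<omega> in M. 2 * (b \<omega> * (u \<bullet> X \<omega>) * (v \<bullet> X \<omega>)) \<le>
        a \<omega> * (u \<bullet> X \<omega>) * (u \<bullet> X \<omega>) + c \<omega> * (v \<bullet> X \<omega>) * (v \<bullet> X \<omega>)"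
      using weights by (rule eventually_mono) (blast intro: weighted_am_gm)
  qed (intro Bochner_Integration.integrable_add integrable_mult_right form int)+
  then show "2 * (u \<bullet> (B *v v)) \<le> u \<bullet> (A *v u) + v \<bullet> (C *v v)"
    by (simp add: A_def B_def C_def form int)
qed (use assms in \<open>simp_all add: pos_def_invertible symmetric_mat_integral_outer pos_def_def\<close>)

theorem theorem2:
  fixes M :: "'a measure" and X :: "'a \<Rightarrow> real ^ 'p" and \<beta>\<^sub>0 :: "real ^ 'p"
    and b b' b'' :: "real \<Rightarrow> real" and L :: "real ^ 'p ^ 'q"
    and \<Phi> \<Gamma> \<Lambda> \<Omega> :: "real ^ 'p ^ 'p"
  defines "\<Phi> \<equiv> Phi M X b'' \<beta>\<^sub>0"
    and "\<Gamma> \<equiv> Gam M X b'' \<beta>\<^sub>0 L"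
    and "\<Lambda> \<equiv> Lam M X b'' \<beta>\<^sub>0 L"
    and "\<Omega> \<equiv> Omeg M X b'' \<beta>\<^sub>0 L"
  assumes "prob_space M"
    and "X \<in> borel_measurable M"
    and "\<And>t. (b has_real_derivative b' t) (at t)"
    and "\<And>t. (b' has_real_derivative b'' t) (at t)"
    and "\<And>t. 0 \<le> b'' t"
    and "AE \<omega> in M. 0 < Lambda_denom b'' \<beta>\<^sub>0 L \<Phi> (X \<omega>)"
    and "integrable M (\<lambda>\<omega>. Phi_integrand b'' \<beta>\<^sub>0 (X \<omega>))" and "pos_def \<Phi>"
    and "integrable M (\<lambda>\<omega>. Gamma_integrand b'' \<beta>\<^sub>0 L \<Phi> (X \<omega>))" and "pos_def \<Gamma>"
    and "integrable M (\<lambda>\<omega>. Lambda_integrand b'' \<beta>\<^sub>0 L \<Phi> (X \<omega>))" and "pos_def \<Lambda>"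
    and "integrable M (\<lambda>\<omega>. Omega_integrand b'' \<beta>\<^sub>0 L \<Phi> (X \<omega>))"
  shows "matrix_inv \<Gamma> \<preceq>\<^sub>L matrix_inv \<Phi> ** \<Lambda> ** matrix_inv \<Phi>
    \<and> matrix_inv \<Phi> \<preceq>\<^sub>L matrix_inv \<Gamma> ** \<Omega> ** matrix_inv \<Gamma>"
proof -
  let ?d = "\<lambda>\<omega>. b'' (X \<omega> \<bullet> \<beta>\<^sub>0)"
  let ?n = "\<lambda>\<omega>. norm ((L ** matrix_inv \<Phi>) *v X \<omega>)"
  let ?l = "\<lambda>\<omega>. Lambda_denom b'' \<beta>\<^sub>0 L \<Phi> (X \<omega>)"
  note integrands = Phi_integrand_def Gamma_integrand_def Lambda_integrand_def Omega_integrand_def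
  have d: "0 \<le> ?d \<omega>" for \<omega>
    by (rule assms)
  \<comment> \<open>In this form the factor \<open>?l \<omega>\<close> of the \<Gamma> weight
    cancels against the denominator of the \<Lambda> weight.\<close>
  have gamma: "?d \<omega> powr (3/2) * ?n \<omega> = ?d \<omega> * ?l \<omega>" for \<omega>
    by (simp add: powr_three_halves d Lambda_denom_def)
  \<comment> \<open>For the second inequality \<Gamma> takes the place of \<open>B\<close>: the
    square of its weight is the \<Phi> weight times the \<Omega> weight.\<close>
  have gamma_square: "(?d \<omega> powr (3/2) * ?n \<omega>)\<^sup>2 = ?d \<omega> * ((?d \<omega>)\<^sup>2 * (?n \<omega>)\<^sup>2)" for \<omega>
    by (simp add: powr_three_halves d power_mult_distrib)
  have "AE \<omega> in M. 0 \<le> ?d \<omega> powr (3/2) * ?n \<omega> \<and> 0 \<le> ?d \<omega> / ?l \<omega> \<and>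
      (?d \<omega>)\<^sup>2 = (?d \<omega> powr (3/2) * ?n \<omega>) * (?d \<omega> / ?l \<omega>)"
    using \<open>AE \<omega> in M. 0 < ?l \<omega>\<close>
    \<comment> \<open>Positivity of \<open>?l \<omega>\<close> matters here: division by zero yields
      0, which would break the product identity wherever \<open>?d \<omega>\<close> is
      nonzero.\<close>
    by eventually_elim (use d in \<open>simp add: gamma power2_eq_square\<close>)
  then have "matrix_inv \<Gamma> \<preceq>\<^sub>L matrix_inv \<Phi> ** \<Lambda> ** matrix_inv \<Phi>"
    using assms loewner_le_weighted_second_moments [of M "\<lambda>\<omega>. ?d \<omega> powr (3/2) * ?n \<omega>" X ?d
        "\<lambda>\<omega>. ?d \<omega> / ?l \<omega>"]
    by (simp add: Phi_def Gam_def Lam_def integrands)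
  moreover have "AE \<omega> in M. 0 \<le> ?d \<omega> \<and> 0 \<le> (?d \<omega>)\<^sup>2 * (?n \<omega>)\<^sup>2 \<and>
      (?d \<omega> powr (3/2) * ?n \<omega>)\<^sup>2 = ?d \<omega> * ((?d \<omega>)\<^sup>2 * (?n \<omega>)\<^sup>2)"
    by (simp add: d gamma_square)
  then have "matrix_inv \<Phi> \<preceq>\<^sub>L matrix_inv \<Gamma> ** \<Omega> ** matrix_inv \<Gamma>"
    using assms loewner_le_weighted_second_moments [of M ?d X "\<lambda>\<omega>. ?d \<omega> powr (3/2) * ?n \<omega>"
        "\<lambda>\<omega>. (?d \<omega>)\<^sup>2 * (?n \<omega>)\<^sup>2"]
    by (simp add: Phi_def Gam_def Omeg_def integrands)
  ultimately show ?thesis ..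
qed

end
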